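(* The topological space $(\mathbb J,\mathfrak T_\sharp(\mathbb J))$ is a Borel space.
   Context: $\mathbb U$ is a Polish space. $\mathfrak P([0,\infty)\times\mathbb U)$ is the set of all Borel probability measures on $[0,\infty)\times\mathbb U$ with the topology of weak convergence. $\mathbb J=L^0([0,\infty);\mathbb U)$ is the set of equivalence classes of $\mathbb U$-valued Borel measurable functions on $[0,\infty)$, where $\mathfrak u_1,\mathfrak u_2$ are equivalent if $\mathfrak u_1(t)=\mathfrak u_2(t)$ for a.e. $t\in(0,\infty)$. $\mathfrak T_\sharp(\mathbb J)$ is the topology on $\mathbb J$ induced by the weak topology of $\mathfrak P([0,\infty)\times\mathbb U)$ via the mapping $\mathfrak i_{\mathbb J}:\mathbb J\ni\mathfrak u\mapsto e^{-t}\delta_{\mathfrak u(t)}(du)\,dt\in\mathfrak P([0,\infty)\times\mathbb U)$. A topological space is called a Borel space if it is homeomorphic to a Borel subset of a complete separable metric space. *)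

theory Defs
  imports "HOL-Probability.Probability"
begin

definition half_strip :: "(real \<times> 'u::polish_space) set" where
  "half_strip = {0..} \<times> UNIV"

definition prob_measures :: "(real \<times> 'u::polish_space) measure set" where
  "prob_measures = {\<mu>. prob_space \<mu> \<and> sets \<mu> = sets (restrict_space borel half_strip)}"

text \<open>The topology of weak convergence is the coarsest topology for which integration
  against every bounded continuous real function on \<open>[0,\<infinity>) \<times> U\<close> is continuous. Taking
  \<open>f = 0\<close> and \<open>V = UNIV\<close> shows that its carrier is all of \<^const>\<open>prob_measures\<close>.\<close>

definition weak_topology :: "(real \<times> 'u::polish_space) measure topology" where
  "weak_topology = topology_generated_by
     {{\<mu> \<in> prob_measures. (\<integral>x. f x \<partial>\<mu>) \<in> V} | (f :: real \<times> 'u \<Rightarrow> real) V.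
        continuous_on half_strip f \<and> bounded (f ` half_strip) \<and> open V}"

text \<open>A function on \<open>[0,\<infinity>)\<close> is represented by a function on \<^typ>\<open>real\<close>. Its values on the
  negative half-line are constrained by neither of the next two definitions, so they disappear
  in the quotient.\<close>

definition L0_funs :: "(real \<Rightarrow> 'u::polish_space) set" where
  "L0_funs = borel_measurable (restrict_space borel {0..})"

definition ae_rel :: "((real \<Rightarrow> 'u::polish_space) \<times> (real \<Rightarrow> 'u)) set" where
  "ae_rel = {(u, v). u \<in> L0_funs \<and> v \<in> L0_funs \<and> (AE t in lborel. 0 < t \<longrightarrow> u t = v t)}"

definition L0 :: "(real \<Rightarrow> 'u::polish_space) set set" where
  "L0 = L0_funs // ae_rel"

text \<open>The measure \<open>e\<^sup>-\<^sup>t \<delta>\<^bsub>u(t)\<^esub>(du) dt\<close> on \<open>[0,\<infinity>) \<times> U\<close>; \<^term>\<open>return borel x\<close> is the Dirac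
  measure at \<open>x\<close>.\<close>

definition control_measure :: "(real \<Rightarrow> 'u::polish_space) \<Rightarrow> (real \<times> 'u) measure" where
  "control_measure u = measure_of half_strip (sets (restrict_space borel half_strip))
     (\<lambda>A. \<integral>\<^sup>+ t\<in>{0..}. ennreal (exp (- t)) * emeasure (return borel (u t)) {x. (t, x) \<in> A} \<partial>lborel)"

text \<open>The common value of \<^const>\<open>control_measure\<close> on an equivalence class; see
  \<open>L0_embed_eq\<close> below.\<close>

definition L0_embed :: "(real \<Rightarrow> 'u::polish_space) set \<Rightarrow> (real \<times> 'u) measure" where
  "L0_embed c = the_elem (control_measure ` c)"

definition sharp_topology :: "(real \<Rightarrow> 'u::polish_space) set topology" where
  "sharp_topology = pullback_topology L0 L0_embed weak_topology"

text \<open>The ambient complete separable metric space may be any one whose points belong to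
  \<^typ>\<open>nat \<Rightarrow> real\<close>. This loses no generality: a separable metric space has at most
  continuum many points, hence is isometric to one of this form.\<close>

definition is_borel_space :: "'a topology \<Rightarrow> bool" where
  "is_borel_space X \<longleftrightarrow>
     (\<exists>m :: (nat \<Rightarrow> real) metric. mcomplete_of m \<and> separable_space (mtopology_of m) \<and>
       (\<exists>B \<in> sigma_sets (mspace m) {U. openin (mtopology_of m) U}.
          X homeomorphic_space subtopology (mtopology_of m) B))"

lemma space_half_strip: "space (restrict_space borel half_strip) = half_strip"
  by (simp add: space_restrict_space)

lemma half_strip_borel: "(half_strip :: (real \<times> 'u::polish_space) set) \<in> sets borel"
  unfolding half_strip_def by (intro borel_closed closed_Times) auto

lemma graph_measurable:
  fixes u :: "real \<Rightarrow> 'u::polish_space"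
  assumes "u \<in> L0_funs"
  shows "(\<lambda>t. (t, u t)) \<in> restrict_space borel {0..} \<rightarrow>\<^sub>M restrict_space borel half_strip"
proof -
  have "u \<in> borel_measurable (restrict_space borel {0..})"
    using assms by (simp add: L0_funs_def)
  moreover have "(\<lambda>t. t) \<in> borel_measurable (restrict_space borel ({0..} :: real set))"
    by (simp add: measurable_restrict_space1)
  ultimately have "(\<lambda>t. (t, u t)) \<in> borel_measurable (restrict_space borel {0..})"
    by (rule borel_measurable_Pair[rotated])
  then show ?thesis
    by (intro measurable_restrict_space2) (auto simp: half_strip_def space_restrict_space)
qed

lemma control_measure_eq_distr:
  fixes u :: "real \<Rightarrow> 'u::polish_space"
  assumes u: "u \<in> L0_funs"
  shows "control_measure u =
    distr (density (restrict_space lborel {0..}) (\<lambda>t. ennreal (exp (- t))))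
      (restrict_space borel half_strip) (\<lambda>t. (t, u t))" (is "_ = ?D")
proof -
  let ?S = "restrict_space borel half_strip :: (real \<times> 'u) measure"
  have sets_lb: "sets (restrict_space lborel {0..}) = sets (restrict_space borel ({0..} :: real set))"
    by (intro sets_restrict_space_cong) simp
  have meas: "(\<lambda>t. (t, u t)) \<in> density (restrict_space lborel {0..}) (\<lambda>t. ennreal (exp (- t))) \<rightarrow>\<^sub>M ?S"
    using graph_measurable[OF u] by (simp add: measurable_cong_sets[OF sets_lb refl])
  have slice: "{x. (t, x) \<in> A} \<in> sets borel" if "A \<in> sets ?S" for A and t :: real
  proof -
    have A: "A \<in> sets borel"
      using that half_strip_borel[where 'u='u]
      by (metis Int_UNIV_right sets_restrict_space_iff space_borel)
    have "(\<lambda>x::'u. (t, x)) \<in> borel_measurable borel"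
      by (intro borel_measurable_continuous_onI continuous_intros)
    from measurable_sets[OF this A] show ?thesis by (simp add: vimage_def)
  qed
  have eq: "emeasure ?D A = (\<integral>\<^sup>+ t\<in>{0..}. ennreal (exp (- t)) *
      emeasure (return borel (u t)) {x. (t, x) \<in> A} \<partial>lborel)" if A: "A \<in> sets ?S" for A
  proof -
    let ?V = "(\<lambda>t. (t, u t)) -` A \<inter> space (restrict_space lborel {0..})"
    have V: "?V \<in> sets (restrict_space lborel {0..})"
      using measurable_sets[OF meas A] by simp
    have dens: "(\<lambda>t::real. ennreal (exp (- t))) \<in> borel_measurable (restrict_space lborel {0..})"
      by (intro measurable_restrict_space1) simp
    have "emeasure ?D A = (\<integral>\<^sup>+ t\<in>?V. ennreal (exp (- t)) \<partial>restrict_space lborel {0..})"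
      unfolding emeasure_distr[OF meas A] space_density by (rule emeasure_density[OF dens V])
    also have "\<dots> = (\<integral>\<^sup>+ t\<in>{0..}. ennreal (exp (- t)) * indicator ?V t \<partial>lborel)"
      by (simp add: nn_integral_restrict_space)
    also have "\<dots> = (\<integral>\<^sup>+ t\<in>{0..}. ennreal (exp (- t)) *
      emeasure (return borel (u t)) {x. (t, x) \<in> A} \<partial>lborel)"
      by (intro nn_integral_cong)
        (auto simp: slice[OF A] space_restrict_space split: split_indicator)
    finally show ?thesis .
  qed
  have "?D = measure_of (space ?S) (sets ?S) (emeasure ?D)"
    by (rule measure_of_of_measure[of ?D, unfolded space_distr sets_distr, symmetric])
  also have "\<dots> = control_measure u"
    unfolding control_measure_def space_half_strip
  proof (rule measure_of_eq)
    show "sets ?S \<subseteq> Pow half_strip"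
      using sets.space_closed[of ?S] by (simp only: space_half_strip)
    show "emeasure ?D A = (\<integral>\<^sup>+ t\<in>{0..}. ennreal (exp (- t)) *
      emeasure (return borel (u t)) {x. (t, x) \<in> A} \<partial>lborel)" if "A \<in> sigma_sets half_strip (sets ?S)" for A
      using that sets.sigma_sets_eq[of ?S] by (intro eq) (simp only: space_half_strip)
  qed
  finally show ?thesis ..
qed

lemma topspace_weak_topology: "topspace weak_topology = (prob_measures :: (real \<times> 'u::polish_space) measure set)"
proof -
  have "prob_measures \<in> {{\<mu> \<in> prob_measures. (\<integral>x. f x \<partial>\<mu>) \<in> V} | (f :: real \<times> 'u \<Rightarrow> real) V.
    continuous_on half_strip f \<and> bounded (f ` half_strip) \<and> open V}"
    by (rule CollectI, rule exI[of _ "\<lambda>_. 0"], rule exI[of _ UNIV]) (auto simp: image_constant_conv)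
  then show ?thesis
    unfolding weak_topology_def topology_generated_by_topspace by blast
qed

lemma control_measure_in_prob_measures:
  fixes u :: "real \<Rightarrow> 'u::polish_space"
  assumes u: "u \<in> L0_funs"
  shows "control_measure u \<in> prob_measures"
proof -
  let ?N = "density (restrict_space lborel {0..}) (\<lambda>t::real. ennreal (exp (- t)))"
  have sets_lb: "sets (restrict_space lborel {0..}) = sets (restrict_space borel ({0..} :: real set))"
    by (intro sets_restrict_space_cong) simp
  have dens: "(\<lambda>t::real. ennreal (exp (- t))) \<in> borel_measurable (restrict_space lborel {0..})"
    by (intro measurable_restrict_space1) simp
  have "emeasure ?N (space ?N) = (\<integral>\<^sup>+ t. ennreal (exp (- t)) \<partial>restrict_space lborel {0..})"
    unfolding space_density emeasure_density[OF dens sets.top]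
    by (rule nn_integral_cong) simp
  also have "\<dots> = (\<integral>\<^sup>+ t. exponential_density 1 t \<partial>lborel)"
    by (subst nn_integral_restrict_space)
      (auto intro!: nn_integral_cong simp: exponential_density_def split: split_indicator)
  also have "\<dots> = 1"
    using prob_space.emeasure_space_1[OF prob_space_exponential_density[of 1]]
    by (simp add: emeasure_density)
  finally have "prob_space ?N" by (rule prob_spaceI)
  moreover have "(\<lambda>t. (t, u t)) \<in> ?N \<rightarrow>\<^sub>M restrict_space borel half_strip"
    using graph_measurable[OF u] by (simp add: measurable_cong_sets[OF sets_lb refl])
  ultimately show ?thesis
    by (simp add: prob_measures_def control_measure_eq_distr[OF u] prob_space.prob_space_distr)
qed

lemma equiv_ae_rel: "equiv L0_funs ae_rel"
proof (rule equivI)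
  show "ae_rel \<subseteq> L0_funs \<times> L0_funs" by (auto simp: ae_rel_def)
  show "refl_on L0_funs ae_rel" by (auto simp: refl_on_def ae_rel_def)
  show "sym ae_rel" unfolding sym_def ae_rel_def by auto
  show "trans ae_rel" unfolding trans_def ae_rel_def by auto
qed

lemma control_measure_cong:
  assumes "(u, v) \<in> ae_rel"
  shows "control_measure u = control_measure v"
proof -
  have ae: "AE t in lborel. 0 < t \<longrightarrow> u t = v t"
    using assms by (auto simp: ae_rel_def)
  have "(\<integral>\<^sup>+ t\<in>{0..}. ennreal (exp (- t)) * emeasure (return borel (u t)) {x. (t, x) \<in> A} \<partial>lborel) =
    (\<integral>\<^sup>+ t\<in>{0..}. ennreal (exp (- t)) * emeasure (return borel (v t)) {x. (t, x) \<in> A} \<partial>lborel)" for A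
    using ae AE_lborel_singleton[of 0]
    by (intro nn_integral_cong_AE) (auto elim!: eventually_elim2 split: split_indicator)
  then show ?thesis by (simp add: control_measure_def)
qed

lemma L0_embed_eq:
  assumes "c \<in> L0" "u \<in> c"
  shows "L0_embed c = control_measure u"
proof -
  have "control_measure ` c = {control_measure u}"
    using assms control_measure_cong quotient_eq_iff[OF equiv_ae_rel, of c c]
    unfolding L0_def by blast
  then show ?thesis by (simp add: L0_embed_def)
qed

lemma topspace_sharp_topology: "topspace sharp_topology = (L0 :: (real \<Rightarrow> 'u::polish_space) set set)"
proof -
  have "L0_embed c \<in> prob_measures" if c: "c \<in> L0" for c :: "(real \<Rightarrow> 'u) set"
  proof -
    obtain u where "u \<in> c" "u \<in> L0_funs"
      using c equiv_class_self[OF equiv_ae_rel] unfolding L0_def by (auto elim!: quotientE)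
    then show ?thesis
      using c by (simp add: L0_embed_eq control_measure_in_prob_measures)
  qed
  then show ?thesis
    by (auto simp: sharp_topology_def topspace_pullback_topology topspace_weak_topology)
qed

end

theory Submission
  imports Defs
begin

text \<open>The topology is that of convergence in probability for the probability \<open>e\<^sup>-\<^sup>t dt\<close>, so it is
  metrized by the complete metric \<open>d(u,v) = \<integral> e\<^sup>-\<^sup>t min 1 (dist (u t) (v t)) dt\<close>. On the other hand,
  countably many integrals against test functions embed it into \<open>\<real>\<^sup>\<nat>\<close>: with \<open>h\<^sub>j x = min 1 (dist x d\<^sub>j)\<close> for
  a dense sequence \<open>d\<^sub>j\<close>, the test functions \<open>max 0 (q - t) * h\<^sub>j x\<close> with \<open>q\<close> rational control the weak
  \<open>L\<^sup>2\<close> limits of \<open>h\<^sub>j (u t)\<close>, and \<open>(h\<^sub>j x)\<^sup>2\<close> controls the \<open>L\<^sup>2\<close> norms, which together give strong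
  convergence and hence convergence in \<open>d\<close>. A completely metrizable subspace of
  the Polish space \<open>\<real>\<^sup>\<nat>\<close> is a \<open>G\<^sub>\<delta>\<close> set, in particular Borel.\<close>

section \<open>Sequential criteria for continuity; truncated distances and Cauchy sequences\<close>

text \<open>In a metric topology closed means sequentially closed, so it suffices that preimages of
  closed sets keep the limits of their sequences.\<close>

lemma (in Metric_space) continuous_map_euclideanI:
  fixes F :: "'a \<Rightarrow> 'b::{first_countable_topology, t2_space}"
  assumes "\<And>\<sigma> l. range \<sigma> \<subseteq> M \<Longrightarrow> l \<in> M \<Longrightarrow> (\<lambda>n. d (\<sigma> n) l) \<longlonglongrightarrow> 0 \<Longrightarrow> (\<lambda>n. F (\<sigma> n)) \<longlonglongrightarrow> F l"
  shows "continuous_map mtopology euclidean F"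
  unfolding continuous_map_closedin
proof (intro conjI allI impI)
  fix C :: "'b set" assume "closedin euclidean C"
  then have C: "closed C" by simp
  show "closedin mtopology {x \<in> topspace mtopology. F x \<in> C}"
    unfolding metric_closedin_iff_sequentially_closed
  proof (intro conjI allI impI)
    fix \<sigma> l assume *: "range \<sigma> \<subseteq> {x \<in> topspace mtopology. F x \<in> C} \<and> limitin mtopology \<sigma> l sequentially"
    then have l: "l \<in> M" by (simp add: limitin_metric)
    from * have r: "range \<sigma> \<subseteq> M" by auto
    have "(\<lambda>n. d (\<sigma> n) l) \<longlonglongrightarrow> 0"
    proof (rule tendstoI)
      fix e :: real assume "0 < e"
      with * have "\<forall>\<^sub>F n in sequentially. \<sigma> n \<in> M \<and> d (\<sigma> n) l < e"
        by (simp add: limitin_metric)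
      then show "\<forall>\<^sub>F n in sequentially. dist (d (\<sigma> n) l) 0 < e"
        by (rule eventually_mono) simp
    qed
    from assms[OF r l this] have "F l \<in> C"
      by (rule closed_sequentially[OF C, rotated]) (use * in auto)
    with l show "l \<in> {x \<in> topspace mtopology. F x \<in> C}" by simp
  qed auto
qed auto

text \<open>The counterpart for maps into an abstract metric space: the preimage \<open>?T\<close>
  of a closed set is relatively closed because every point of \<open>S\<close> in
  \<open>closure ?T\<close> is the limit of a sequence in \<open>?T\<close>.\<close>

lemma (in Metric_space) continuous_map_from_euclideanI:
  fixes g :: "'b::metric_space \<Rightarrow> 'a"
  assumes "\<And>y. y \<in> S \<Longrightarrow> g y \<in> M"
    and "\<And>\<sigma> l. range \<sigma> \<subseteq> S \<Longrightarrow> l \<in> S \<Longrightarrow> \<sigma> \<longlonglongrightarrow> l \<Longrightarrow> (\<lambda>n. d (g (\<sigma> n)) (g l)) \<longlonglongrightarrow> 0"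
  shows "continuous_map (top_of_set S) mtopology g"
  unfolding continuous_map_closedin
proof (intro conjI allI impI)
  fix C assume C: "closedin mtopology C"
  let ?T = "{y \<in> S. g y \<in> C}"
  have "l \<in> ?T" if l: "l \<in> S" "l \<in> closure ?T" for l
  proof -
    from l(2) obtain \<sigma> where \<sigma>: "\<And>n. \<sigma> n \<in> ?T" "\<sigma> \<longlonglongrightarrow> l"
      unfolding closure_sequential by blast
    then have lim: "(\<lambda>n. d (g (\<sigma> n)) (g l)) \<longlonglongrightarrow> 0"
      using l(1) by (intro assms(2)) auto
    have "limitin mtopology (\<lambda>n. g (\<sigma> n)) (g l) sequentially"
      unfolding limitin_metric
    proof (intro conjI allI impI)
      fix e :: real assume "0 < e"
      from order_tendstoD(2)[OF lim this]
      show "\<forall>\<^sub>F n in sequentially. g (\<sigma> n) \<in> M \<and> d (g (\<sigma> n)) (g l) < e"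
        by (rule eventually_mono) (use \<sigma>(1) assms(1) in auto)
    qed (use l(1) assms(1) in auto)
    moreover have "range (\<lambda>n. g (\<sigma> n)) \<subseteq> C" using \<sigma>(1) by auto
    ultimately have "g l \<in> C"
      using C unfolding metric_closedin_iff_sequentially_closed by blast
    with l(1) show ?thesis by simp
  qed
  then have "?T = S \<inter> closure ?T"
    using closure_subset[of ?T] by auto
  then show "closedin (top_of_set S) {x \<in> topspace (top_of_set S). g x \<in> C}"
    using closedin_closed[of S ?T] closed_closure[of ?T] by auto
qed (use assms(1) in auto)

text \<open>By the triangle inequality, \<open>dist (x m) (x n)\<close> is bounded by a block of the
  convergent series.\<close>

lemma summable_dist_imp_Cauchy:
  fixes x :: "nat \<Rightarrow> 'a::metric_space"
  assumes "summable (\<lambda>n. dist (x n) (x (Suc n)))"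
  shows "Cauchy x"
proof (rule metric_CauchyI)
  fix e :: real assume e: "0 < e"
  have le: "dist (x m) (x n) \<le> (\<Sum>i=m..<n. dist (x i) (x (Suc i)))" if "m \<le> n" for m n
    using that
  proof (induction n rule: dec_induct)
    case (step n)
    then show ?case using dist_triangle[of "x m" "x (Suc n)" "x n"] by simp
  qed simp
  from assms e obtain K where K: "\<And>m n. m \<ge> K \<Longrightarrow> norm (\<Sum>i=m..<n. dist (x i) (x (Suc i))) < e"
    unfolding summable_Cauchy by blast
  have "dist (x m) (x n) < e" if "K \<le> m" "m \<le> n" for m n
    using le[OF that(2)] K[OF that(1), of n] by simp
  then have "dist (x m) (x n) < e" if "K \<le> m" "K \<le> n" for m n
    using that by (metis dist_commute nle_le)
  then show "\<exists>K. \<forall>m\<ge>K. \<forall>n\<ge>K. dist (x m) (x n) < e" by blast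
qed

lemma tendsto_min_one_dist_iff:
  fixes x :: "nat \<Rightarrow> 'a::metric_space"
  shows "(\<lambda>n. min 1 (dist (x n) l)) \<longlonglongrightarrow> 0 \<longleftrightarrow> x \<longlonglongrightarrow> l"
proof
  assume *: "(\<lambda>n. min 1 (dist (x n) l)) \<longlonglongrightarrow> 0"
  show "x \<longlonglongrightarrow> l"
    unfolding tendsto_iff
  proof (intro allI impI)
    fix e :: real assume "0 < e"
    \<comment> \<open>Below the threshold \<open>min 1 e\<close> the truncation is inactive and the
      minimum is the distance itself.\<close>
    then have "\<forall>\<^sub>F n in sequentially. min 1 (dist (x n) l) < min 1 e"
      by (intro order_tendstoD(2)[OF *]) simp
    then show "\<forall>\<^sub>F n in sequentially. dist (x n) l < e"
      by (rule eventually_mono) (auto simp: min_def split: if_splits)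
  qed
next
  assume "x \<longlonglongrightarrow> l"
  then have "(\<lambda>n. min 1 (dist (x n) l)) \<longlonglongrightarrow> min 1 (dist l l)"
    by (intro tendsto_intros)
  then show "(\<lambda>n. min 1 (dist (x n) l)) \<longlonglongrightarrow> 0" by simp
qed

text \<open>The terms of a convergent series are eventually below 1, so the truncated and the true
  distances agree from some index on.\<close>

lemma summable_min_one_dist_imp_Cauchy:
  fixes x :: "nat \<Rightarrow> 'a::metric_space"
  assumes *: "summable (\<lambda>n. min 1 (dist (x n) (x (Suc n))))"
  shows "Cauchy x"
proof (rule summable_dist_imp_Cauchy)
  have "\<forall>\<^sub>F n in sequentially. min 1 (dist (x n) (x (Suc n))) < 1"
    by (rule order_tendstoD(2)[OF summable_LIMSEQ_zero[OF *]]) simp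
  then have "\<forall>\<^sub>F n in sequentially. min 1 (dist (x n) (x (Suc n))) = dist (x n) (x (Suc n))"
    by (rule eventually_mono) (auto simp: min_def split: if_splits)
  from summable_cong[OF this] * show "summable (\<lambda>n. dist (x n) (x (Suc n)))" by simp
qed

section \<open>Convergence in probability\<close>

text \<open>Truncation at 1 makes the integral finite for all measurable functions on a probability
  space; the result is a pseudometric for convergence in probability.\<close>

definition prob_dist :: "'a measure \<Rightarrow> ('a \<Rightarrow> 'b::polish_space) \<Rightarrow> ('a \<Rightarrow> 'b) \<Rightarrow> real" where
  "prob_dist M u v = (\<integral>t. min 1 (dist (u t) (v t)) \<partial>M)"

lemma prob_dist_commute: "prob_dist M u v = prob_dist M v u"
  by (simp add: prob_dist_def dist_commute)

lemma prob_dist_nonneg: "0 \<le> prob_dist M u v"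
  unfolding prob_dist_def by (rule integral_nonneg_AE) simp

context prob_space
begin

lemma integrable_min_one_dist:
  fixes u v :: "'a \<Rightarrow> 'b::polish_space"
  assumes [measurable]: "u \<in> borel_measurable M" "v \<in> borel_measurable M"
  shows "integrable M (\<lambda>t. min 1 (dist (u t) (v t)))"
  by (rule integrable_const_bound[of _ 1]) auto

lemma prob_dist_eq_0_iff:
  fixes u v :: "'a \<Rightarrow> 'b::polish_space"
  assumes "u \<in> borel_measurable M" "v \<in> borel_measurable M"
  shows "prob_dist M u v = 0 \<longleftrightarrow> (AE t in M. u t = v t)"
  unfolding prob_dist_def
  by (subst integral_nonneg_eq_0_iff_AE[OF integrable_min_one_dist[OF assms]])
    (auto intro!: AE_cong simp: min_def)

lemma prob_dist_triangle:
  fixes u v w :: "'a \<Rightarrow> 'b::polish_space"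
  assumes "u \<in> borel_measurable M" "v \<in> borel_measurable M" "w \<in> borel_measurable M"
  shows "prob_dist M u w \<le> prob_dist M u v + prob_dist M v w"
proof -
  have "min 1 (dist (u t) (w t)) \<le> min 1 (dist (u t) (v t)) + min 1 (dist (v t) (w t))" for t
    using dist_triangle[of "u t" "w t" "v t"] zero_le_dist[of "u t" "v t"] zero_le_dist[of "v t" "w t"]
    unfolding min_def by (auto simp del: zero_le_dist)
  then have "(\<integral>t. min 1 (dist (u t) (w t)) \<partial>M) \<le>
      (\<integral>t. min 1 (dist (u t) (v t)) + min 1 (dist (v t) (w t)) \<partial>M)"
    by (intro integral_mono Bochner_Integration.integrable_add integrable_min_one_dist assms) auto
  then show ?thesis
    unfolding prob_dist_def
    by (simp add: integrable_min_one_dist assms)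
qed

lemma prob_dist_cong_AE:
  assumes "AE t in M. u t = u' t" "AE t in M. v t = v' t"
    and "u \<in> borel_measurable M" "v \<in> borel_measurable M"
    and "u' \<in> borel_measurable M" "v' \<in> borel_measurable M"
  shows "prob_dist M u v = prob_dist M u' (v' :: 'a \<Rightarrow> 'b::polish_space)"
  unfolding prob_dist_def
  using assms by (intro integral_cong_AE) auto

lemma AE_tendsto_imp_prob_dist_tendsto:
  fixes u :: "nat \<Rightarrow> 'a \<Rightarrow> 'b::polish_space"
  assumes [measurable]: "\<And>n. u n \<in> borel_measurable M" "v \<in> borel_measurable M"
    and lim: "AE t in M. (\<lambda>n. u n t) \<longlonglongrightarrow> v t"
  shows "(\<lambda>n. prob_dist M (u n) v) \<longlonglongrightarrow> 0"
proof -
  have "(\<lambda>n. \<integral>t. min 1 (dist (u n t) (v t)) \<partial>M) \<longlonglongrightarrow> (\<integral>t. 0 \<partial>M)"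
  proof (rule integral_dominated_convergence[where w="\<lambda>_. 1"])
    show "AE t in M. (\<lambda>n. min 1 (dist (u n t) (v t))) \<longlonglongrightarrow> 0"
      using lim by (simp add: tendsto_min_one_dist_iff)
  qed auto
  then show ?thesis by (simp add: prob_dist_def)
qed

text \<open>\<open>prob_dist\<close> is the L1 norm of the truncated distance, and L1 convergence
  yields an almost everywhere convergent subsequence.\<close>

lemma prob_dist_tendsto_imp_AE_subseq:
  fixes u :: "nat \<Rightarrow> 'a \<Rightarrow> 'b::polish_space"
  assumes [measurable]: "\<And>n. u n \<in> borel_measurable M" "v \<in> borel_measurable M"
    and lim: "(\<lambda>n. prob_dist M (u n) v) \<longlonglongrightarrow> 0"
  shows "\<exists>r. strict_mono r \<and> (AE t in M. (\<lambda>n. u (r n) t) \<longlonglongrightarrow> v t)"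
  using tendsto_L1_AE_subseq[of M "\<lambda>n t. min 1 (dist (u n t) (v t))"] lim
  by (simp add: tendsto_min_one_dist_iff integrable_min_one_dist prob_dist_def)

text \<open>Otherwise a subsequence of the integrals stays a fixed amount away from the limit. It
  has a further subsequence along which the functions converge almost everywhere, and there
  dominated convergence with the bound \<open>B\<close> gives a contradiction.\<close>

lemma prob_dist_tendsto_imp_integral_tendsto:
  fixes u :: "nat \<Rightarrow> 'a \<Rightarrow> 'b::polish_space" and F :: "'a \<Rightarrow> 'b \<Rightarrow> real"
  assumes [measurable]: "\<And>n. u n \<in> borel_measurable M" "v \<in> borel_measurable M"
    and lim: "(\<lambda>n. prob_dist M (u n) v) \<longlonglongrightarrow> 0"
    and [measurable]: "\<And>n. (\<lambda>t. F t (u n t)) \<in> borel_measurable M" "(\<lambda>t. F t (v t)) \<in> borel_measurable M"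
    and bound: "\<And>t x. t \<in> space M \<Longrightarrow> \<bar>F t x\<bar> \<le> B"
    and cont: "\<And>t. t \<in> space M \<Longrightarrow> continuous_on UNIV (F t)"
  shows "(\<lambda>n. \<integral>t. F t (u n t) \<partial>M) \<longlonglongrightarrow> (\<integral>t. F t (v t) \<partial>M)"
proof (rule ccontr)
  assume "\<not> ?thesis"
  then obtain e where e: "0 < e"
    and "\<not> (\<forall>\<^sub>F n in sequentially. dist (\<integral>t. F t (u n t) \<partial>M) (\<integral>t. F t (v t) \<partial>M) < e)"
    unfolding tendsto_iff by blast
  then have "infinite {n. e \<le> dist (\<integral>t. F t (u n t) \<partial>M) (\<integral>t. F t (v t) \<partial>M)}"
    by (simp add: frequently_cofinite[symmetric] cofinite_eq_sequentially not_eventually not_less)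
  then obtain r :: "nat \<Rightarrow> nat" where r: "strict_mono r"
    and far: "\<And>n. e \<le> dist (\<integral>t. F t (u (r n) t) \<partial>M) (\<integral>t. F t (v t) \<partial>M)"
    using infinite_enumerate by blast
  have "(\<lambda>n. prob_dist M (u (r n)) v) \<longlonglongrightarrow> 0"
    using LIMSEQ_subseq_LIMSEQ[OF lim r] by (simp add: o_def)
  then obtain s where s: "strict_mono s" and ae: "AE t in M. (\<lambda>n. u (r (s n)) t) \<longlonglongrightarrow> v t"
    using prob_dist_tendsto_imp_AE_subseq[of "\<lambda>n. u (r n)" v] by auto
  have "(\<lambda>n. \<integral>t. F t (u (r (s n)) t) \<partial>M) \<longlonglongrightarrow> (\<integral>t. F t (v t) \<partial>M)"
  proof (rule integral_dominated_convergence[where w="\<lambda>_. B"])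
    show "AE t in M. (\<lambda>n. F t (u (r (s n)) t)) \<longlonglongrightarrow> F t (v t)"
      using ae AE_space
    proof eventually_elim
      case (elim t)
      then show ?case
        using continuous_on_tendsto_compose[OF cont[of t] elim(1)] by simp
    qed
    show "AE t in M. norm (F t (u (r (s n)) t)) \<le> B" for n
      using AE_space by eventually_elim (simp add: bound)
  qed auto
  from tendstoD[OF this e] show False
    using far by (auto simp: not_less[symmetric] eventually_False_sequentially)
qed

text \<open>A subsequence with summable consecutive distances converges almost everywhere.\<close>

lemma prob_dist_complete:
  fixes u :: "nat \<Rightarrow> 'a \<Rightarrow> 'b::polish_space"
  assumes [measurable]: "\<And>n. u n \<in> borel_measurable M"
    and Cauchy: "\<And>e. 0 < e \<Longrightarrow> \<exists>K. \<forall>m\<ge>K. \<forall>n\<ge>K. prob_dist M (u m) (u n) < e"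
  obtains r v where "strict_mono r" "v \<in> borel_measurable M" "(\<lambda>n. prob_dist M (u (r n)) v) \<longlonglongrightarrow> 0"
proof -
  have "\<exists>K. \<forall>m\<ge>K. \<forall>n\<ge>K. prob_dist M (u m) (u n) < (1/2) ^ k" for k :: nat
    by (rule Cauchy) simp
  then obtain K where K: "\<And>k m n. m \<ge> K k \<Longrightarrow> n \<ge> K k \<Longrightarrow> prob_dist M (u m) (u n) < (1/2) ^ k"
    by metis
  \<comment> \<open>\<open>Suc m\<close> makes \<open>r\<close> strictly increasing, and
    \<open>K (Suc k)\<close> keeps \<open>r k\<close> beyond the threshold for
    \<open>(1/2) ^ k\<close>.\<close>
  define r where "r = rec_nat (K 0) (\<lambda>k m. max (Suc m) (K (Suc k)))"
  have r: "strict_mono r" by (rule strict_monoI_Suc) (simp add: r_def)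
  have rK: "r k \<ge> K k" for k by (cases k) (simp_all add: r_def)
  \<comment> \<open>The expectation of the sum of all \<open>e n\<close> is at most the sum of the
    \<open>(1/2) ^ n\<close>. Hence the sum is finite almost everywhere, which makes the subsequence
    Cauchy there.\<close>
  define e where "e n t = min 1 (dist (u (r n) t) (u (r (Suc n)) t))" for n t
  have [measurable]: "e n \<in> borel_measurable M" for n unfolding e_def by measurable
  have e0: "0 \<le> e n t" for n t by (simp add: e_def)
  have le: "(\<integral>t. e n t \<partial>M) \<le> (1/2) ^ n" for n
    using K[of n "r n" "r (Suc n)"] rK[of n] strict_mono_leD[OF r, of n "Suc n"]
    by (simp add: prob_dist_def e_def)
  have "(\<integral>\<^sup>+t. (\<Sum>n. ennreal (e n t)) \<partial>M) = (\<Sum>n. \<integral>\<^sup>+t. ennreal (e n t) \<partial>M)"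
    by (rule nn_integral_suminf) simp
  also have "\<dots> = (\<Sum>n. ennreal (\<integral>t. e n t \<partial>M))"
    by (intro suminf_cong nn_integral_eq_integral)
      (auto simp: e0 intro!: integrable_min_one_dist[folded e_def] simp: e_def)
  also have "\<dots> \<le> (\<Sum>n. ennreal ((1/2) ^ n))"
    by (intro suminf_le ennreal_leI le) auto
  also have "\<dots> < \<top>"
    by (subst suminf_ennreal2) (auto simp: summable_geometric)
  finally have "AE t in M. (\<Sum>n. ennreal (e n t)) \<noteq> \<infinity>"
    by (intro nn_integral_PInf_AE) auto
  then have ae: "AE t in M. convergent (\<lambda>n. u (r n) t)"
  proof eventually_elim
    case (elim t)
    then have "summable (\<lambda>n. e n t)"
      by (intro summable_suminf_not_top) (auto simp: e0)
    then show ?case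
      unfolding e_def by (intro Cauchy_convergent summable_min_one_dist_imp_Cauchy)
  qed
  then obtain Z where Z: "Z \<in> null_sets M" "{t \<in> space M. \<not> convergent (\<lambda>n. u (r n) t)} \<subseteq> Z"
    unfolding eventually_ae_filter by blast
  have [measurable]: "Z \<in> sets M" using Z by auto
  \<comment> \<open>Replacing the sequence by a constant on the null set \<open>Z\<close> makes it
    converge at every point of the space, so that the limit \<open>v\<close> is measurable.\<close>
  define w where "w n t = (if t \<in> Z then undefined else u (r n) t)" for n t
  have [measurable]: "w n \<in> borel_measurable M" for n unfolding w_def by measurable
  define v where "v t = lim (\<lambda>n. w n t)" for t
  have wv: "(\<lambda>n. w n t) \<longlonglongrightarrow> v t" if "t \<in> space M" for t
    using that Z unfolding v_def w_def convergent_LIMSEQ_iff[symmetric]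
    by (cases "t \<in> Z") (auto simp: convergent_const)
  have v [measurable]: "v \<in> borel_measurable M"
    by (rule borel_measurable_LIMSEQ_metric[OF _ wv]) auto
  have "AE t in M. (\<lambda>n. u (r n) t) \<longlonglongrightarrow> v t"
    using AE_not_in[OF Z(1)] AE_space
  proof eventually_elim
    case (elim t)
    then show ?case using wv[of t] by (simp add: w_def)
  qed
  then have "(\<lambda>n. prob_dist M (u (r n)) v) \<longlonglongrightarrow> 0"
    by (intro AE_tendsto_imp_prob_dist_tendsto) auto
  with r v show thesis by (rule that)
qed

section \<open>Weak limits of bounded functions, and passage to strong limits\<close>

lemma integrable_mult_unit_bounded:
  fixes f g :: "'a \<Rightarrow> real"
  assumes "integrable M f" and [measurable]: "g \<in> borel_measurable M" and "\<And>t. \<bar>g t\<bar> \<le> 1"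
  shows "integrable M (\<lambda>t. f t * g t)"
proof (rule Bochner_Integration.integrable_bound[OF assms(1)])
  show "AE t in M. norm (f t * g t) \<le> norm (f t)"
    using assms(3) by (auto simp: abs_mult intro!: mult_left_le)
qed (use assms(1) in measurable)

text \<open>An \<open>e/3\<close> argument: by dominated convergence \<open>s i\<close> tends to
  \<open>f\<close> in L1. Since all \<open>g n\<close> and \<open>g'\<close> are bounded by 1,
  replacing \<open>f\<close> by one such \<open>s i\<close> costs less than \<open>e/3\<close>
  uniformly in \<open>n\<close>.\<close>

lemma weak_limit_dominated:
  fixes g :: "nat \<Rightarrow> 'a \<Rightarrow> real"
  assumes g: "\<And>n. g n \<in> borel_measurable M" "\<And>n t. \<bar>g n t\<bar> \<le> 1"
    and g': "g' \<in> borel_measurable M" "\<And>t. \<bar>g' t\<bar> \<le> 1"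
    and s: "\<And>i. integrable M (s i)" "\<And>i. (\<lambda>n. \<integral>t. s i t * g n t \<partial>M) \<longlonglongrightarrow> (\<integral>t. s i t * g' t \<partial>M)"
    and f: "integrable M f" and w: "integrable M w"
    and lim: "\<And>t. t \<in> space M \<Longrightarrow> (\<lambda>i. s i t) \<longlonglongrightarrow> f t"
    and bound: "\<And>i t. t \<in> space M \<Longrightarrow> \<bar>s i t\<bar> \<le> w t"
  shows "(\<lambda>n. \<integral>t. f t * g n t \<partial>M) \<longlonglongrightarrow> (\<integral>t. f t * g' t \<partial>M)"
proof (rule tendstoI)
  fix e :: real assume e: "0 < e"
  have "(\<lambda>i. \<integral>t. \<bar>s i t - f t\<bar> \<partial>M) \<longlonglongrightarrow> (\<integral>t. 0 \<partial>M)"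
  proof (rule integral_dominated_convergence[where w="\<lambda>t. w t + \<bar>f t\<bar>"])
    show "AE t in M. (\<lambda>i. \<bar>s i t - f t\<bar>) \<longlonglongrightarrow> 0"
      using AE_space
    proof eventually_elim
      case (elim t)
      from lim[OF this] have "(\<lambda>i. s i t - f t) \<longlonglongrightarrow> 0" by (simp add: LIM_zero_iff)
      then show ?case by (rule tendsto_rabs_zero)
    qed
    show "AE t in M. norm \<bar>s i t - f t\<bar> \<le> w t + \<bar>f t\<bar>" for i
      using AE_space
    proof eventually_elim
      case (elim t)
      from bound[OF this, of i] show ?case by simp
    qed
  qed (use s(1) f w in auto)
  then have "(\<lambda>i. \<integral>t. \<bar>s i t - f t\<bar> \<partial>M) \<longlonglongrightarrow> 0" by simp
  from order_tendstoD(2)[OF this, of "e/3"] e obtain i where i: "(\<integral>t. \<bar>s i t - f t\<bar> \<partial>M) < e/3"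
    by (auto simp: eventually_sequentially)
  have close: "\<bar>(\<integral>t. s i t * h t \<partial>M) - (\<integral>t. f t * h t \<partial>M)\<bar> < e/3"
    if h: "h \<in> borel_measurable M" "\<And>t. \<bar>h t\<bar> \<le> 1" for h
  proof -
    have "(\<integral>t. s i t * h t \<partial>M) - (\<integral>t. f t * h t \<partial>M) = (\<integral>t. (s i t - f t) * h t \<partial>M)"
      by (simp add: left_diff_distrib integrable_mult_unit_bounded s f h)
    also have "\<bar>\<dots>\<bar> \<le> (\<integral>t. \<bar>(s i t - f t) * h t\<bar> \<partial>M)"
      by (rule integral_abs_bound)
    also have "\<dots> \<le> (\<integral>t. \<bar>s i t - f t\<bar> \<partial>M)"
      using h s(1) f by (intro integral_mono integrable_abs integrable_mult_unit_bounded)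
        (auto simp: abs_mult intro!: mult_left_le)
    finally show ?thesis using i by simp
  qed
  have "\<forall>\<^sub>F n in sequentially. dist (\<integral>t. s i t * g n t \<partial>M) (\<integral>t. s i t * g' t \<partial>M) < e/3"
    using e by (intro tendstoD[OF s(2)]) simp
  then show "\<forall>\<^sub>F n in sequentially. dist (\<integral>t. f t * g n t \<partial>M) (\<integral>t. f t * g' t \<partial>M) < e"
  proof eventually_elim
    case (elim n)
    with close[OF g, of n] close[OF g'] show ?case
      unfolding dist_real_def by linarith
  qed
qed

text \<open>Dynkin's argument extends the limit from the pi-system \<open>G\<close> to all
  measurable sets, and induction over integrable functions extends it to \<open>f\<close>. Both
  countable limit steps are instances of \<open>weak_limit_dominated\<close>.\<close>

lemma weak_limit_from_generator:
  fixes g :: "nat \<Rightarrow> 'a \<Rightarrow> real"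
  assumes g: "\<And>n. g n \<in> borel_measurable M" "\<And>n t. \<bar>g n t\<bar> \<le> 1"
    and g': "g' \<in> borel_measurable M" "\<And>t. \<bar>g' t\<bar> \<le> 1"
    and gen: "sets M = sigma_sets (space M) G" "Int_stable G" "G \<subseteq> Pow (space M)"
    and base: "\<And>A. A \<in> G \<Longrightarrow> (\<lambda>n. \<integral>t. indicator A t * g n t \<partial>M) \<longlonglongrightarrow> (\<integral>t. indicator A t * g' t \<partial>M)"
    and space: "(\<lambda>n. \<integral>t. g n t \<partial>M) \<longlonglongrightarrow> (\<integral>t. g' t \<partial>M)"
    and f: "integrable M f"
  shows "(\<lambda>n. \<integral>t. f t * g n t \<partial>M) \<longlonglongrightarrow> (\<integral>t. f t * g' t \<partial>M)"
  using f
proof (induction rule: integrable_induct)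
  case (base A c)
  have ind: "integrable M (indicator B :: 'a \<Rightarrow> real)" if "B \<in> sets M" for B
    using that by (intro integrable_real_indicator) (simp_all add: less_top[symmetric])
  note int = integrable_mult_unit_bounded[OF ind g] integrable_mult_unit_bounded[OF ind g']
  from gen base(1) have "A \<in> sigma_sets (space M) G" by simp
  with gen(2,3) have "(\<lambda>n. \<integral>t. indicator A t * g n t \<partial>M) \<longlonglongrightarrow> (\<integral>t. indicator A t * g' t \<partial>M)"
  proof (induction rule: sigma_sets_induct_disjoint)
    case (basic A)
    then show ?case by (rule assms(8))
  next
    case empty
    then show ?case by simp
  next
    case (compl A)
    then have A: "A \<in> sets M" using gen by simp
    \<comment> \<open>The integral over a complement is the difference from the integral over the
      whole space, whose limit is the hypothesis \<open>space\<close>.\<close>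
    have eq: "(\<integral>t. indicator (space M - A) t * h t \<partial>M) = (\<integral>t. h t \<partial>M) - (\<integral>t. indicator A t * h t \<partial>M)"
      if h: "h \<in> borel_measurable M" "\<And>t. \<bar>h t\<bar> \<le> 1" for h :: "'a \<Rightarrow> real"
    proof -
      have "integrable M h"
        by (rule integrable_const_bound[of _ 1]) (use h in auto)
      then have "(\<integral>t. h t \<partial>M) - (\<integral>t. indicator A t * h t \<partial>M) = (\<integral>t. h t - indicator A t * h t \<partial>M)"
        by (simp add: integrable_mult_unit_bounded[OF ind[OF A] h])
      also have "\<dots> = (\<integral>t. indicator (space M - A) t * h t \<partial>M)"
        by (intro Bochner_Integration.integral_cong) (auto split: split_indicator)
      finally show ?thesis ..
    qed
    show ?case
      unfolding eq[OF g] eq[OF g'] by (intro tendsto_diff space compl.IH)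
  next
    case (union A)
    then have A: "A i \<in> sets M" for i using gen by auto
    \<comment> \<open>By disjointness the partial sums of the indicators are themselves indicators,
      hence bounded by 1, and they converge to the indicator of the union.\<close>
    show ?case
    proof (rule weak_limit_dominated[OF g g', where s="\<lambda>i t. \<Sum>k<i. indicator (A k) t" and w="\<lambda>_. 1"])
      fix i
      have eq: "(\<integral>t. (\<Sum>k<i. indicator (A k) t) * h t \<partial>M) = (\<Sum>k<i. \<integral>t. indicator (A k) t * h t \<partial>M)"
        if h: "h \<in> borel_measurable M" "\<And>t. \<bar>h t\<bar> \<le> 1" for h :: "'a \<Rightarrow> real"
        unfolding sum_distrib_right
        by (intro Bochner_Integration.integral_sum integrable_mult_unit_bounded[OF ind[OF A] h])
      show "(\<lambda>n. \<integral>t. (\<Sum>k<i. indicator (A k) t) * g n t \<partial>M) \<longlonglongrightarrow> (\<integral>t. (\<Sum>k<i. indicator (A k) t) * g' t \<partial>M)"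
        unfolding eq[OF g] eq[OF g'] by (intro tendsto_sum union.IH)
      show "integrable M (\<lambda>t. \<Sum>k<i. indicator (A k) t :: real)"
        by (intro Bochner_Integration.integrable_sum ind A)
    next
      fix t
      have "(\<lambda>i. indicator (A i) t :: real) sums indicator (\<Union>i. A i) t"
        using union.hyps(1) by (intro indicator_sums) (auto simp: disjoint_family_on_def)
      then show "(\<lambda>i. \<Sum>k<i. indicator (A k) t :: real) \<longlonglongrightarrow> indicator (\<Union>i. A i) t"
        by (simp add: sums_def)
      fix i
      have "(\<Sum>k<i. indicator (A k) t :: real) = indicator (\<Union>k<i. A k) t"
        using union.hyps(1) by (intro indicator_UN_disjoint[symmetric]) (auto simp: disjoint_family_on_def)
      then show "\<bar>\<Sum>k<i. indicator (A k) t\<bar> \<le> (1::real)" by (simp add: indicator_def)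
    qed (use A ind in auto)
  qed
  then have "(\<lambda>n. c * (\<integral>t. indicator A t * g n t \<partial>M)) \<longlonglongrightarrow> c * (\<integral>t. indicator A t * g' t \<partial>M)"
    by (rule tendsto_mult_left)
  then show ?case
    by (simp add: mult.assoc mult.left_commute[of _ c])
next
  case (add f1 f2)
  have "(\<integral>t. (f1 t + f2 t) * h t \<partial>M) = (\<integral>t. f1 t * h t \<partial>M) + (\<integral>t. f2 t * h t \<partial>M)"
    if h: "h \<in> borel_measurable M" "\<And>t. \<bar>h t\<bar> \<le> 1" for h
    by (simp add: distrib_right integrable_mult_unit_bounded[OF _ h] add.hyps)
  note eq = this
  show ?case
    unfolding eq[OF g] eq[OF g'] by (intro tendsto_add add.IH)
next
  case (lim f s)
  show ?case
  proof (rule weak_limit_dominated[OF g g' lim.hyps(1) lim.IH lim.hyps(4)])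
    \<comment> \<open>The approximants supplied by the induction satisfy the bound
      \<open>2 * \<bar>f t\<bar>\<close>.\<close>
    show "integrable M (\<lambda>t. 2 * \<bar>f t\<bar>)" using lim.hyps(4) by simp
  qed (use lim.hyps in auto)
qed

text \<open>Expanding the square, the L2 distance from \<open>g n\<close> to \<open>g'\<close> tends
  to 0: the norms converge and the cross term converges by weak convergence. On a probability space
  the L1 norm is at most the L2 norm.\<close>

lemma weak_and_norm_limit_imp_L1:
  fixes g :: "nat \<Rightarrow> 'a \<Rightarrow> real"
  assumes g: "\<And>n. g n \<in> borel_measurable M" "\<And>n t. \<bar>g n t\<bar> \<le> 1"
    and g': "g' \<in> borel_measurable M" "\<And>t. \<bar>g' t\<bar> \<le> 1"
    and weak: "(\<lambda>n. \<integral>t. g' t * g n t \<partial>M) \<longlonglongrightarrow> (\<integral>t. g' t * g' t \<partial>M)"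
    and norm: "(\<lambda>n. \<integral>t. (g n t)\<^sup>2 \<partial>M) \<longlonglongrightarrow> (\<integral>t. (g' t)\<^sup>2 \<partial>M)"
  shows "(\<lambda>n. \<integral>t. \<bar>g n t - g' t\<bar> \<partial>M) \<longlonglongrightarrow> 0"
proof -
  note [measurable] = g(1) g'(1)
  have int: "integrable M (g n)" "integrable M g'" for n
    by (rule integrable_const_bound[of _ 1]; use g g' in auto)+
  note mult = integrable_mult_unit_bounded[OF int(1) g(1,2)] integrable_mult_unit_bounded[OF int(2) g']
    integrable_mult_unit_bounded[OF int(2) g(1,2)] integrable_mult_unit_bounded[OF int(1) g']
  have sq: "(\<integral>t. (g n t - g' t)\<^sup>2 \<partial>M) =
      (\<integral>t. (g n t)\<^sup>2 \<partial>M) - 2 * (\<integral>t. g' t * g n t \<partial>M) + (\<integral>t. (g' t)\<^sup>2 \<partial>M)" for n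
  proof -
    have "(\<integral>t. (g n t - g' t)\<^sup>2 \<partial>M) = (\<integral>t. (g n t)\<^sup>2 - 2 * (g' t * g n t) + (g' t)\<^sup>2 \<partial>M)"
      by (intro Bochner_Integration.integral_cong) (auto simp: power2_eq_square algebra_simps)
    then show ?thesis by (simp add: power2_eq_square mult)
  qed
  have "(\<lambda>n. \<integral>t. (g n t - g' t)\<^sup>2 \<partial>M) \<longlonglongrightarrow>
      (\<integral>t. (g' t)\<^sup>2 \<partial>M) - 2 * (\<integral>t. g' t * g' t \<partial>M) + (\<integral>t. (g' t)\<^sup>2 \<partial>M)"
    unfolding sq by (intro tendsto_intros norm weak)
  then have lim: "(\<lambda>n. sqrt (\<integral>t. (g n t - g' t)\<^sup>2 \<partial>M)) \<longlonglongrightarrow> 0"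
    using tendsto_real_sqrt by (fastforce simp: power2_eq_square)
  have "(\<integral>t. \<bar>g n t - g' t\<bar> \<partial>M) \<le> sqrt (\<integral>t. (g n t - g' t)\<^sup>2 \<partial>M)" for n
  proof (rule real_le_rsqrt)
    have i: "integrable M (\<lambda>t. \<bar>g n t - g' t\<bar>)" using int by auto
    have "integrable M (\<lambda>t. (g n t)\<^sup>2 - 2 * (g' t * g n t) + (g' t)\<^sup>2)"
      by (simp add: power2_eq_square mult)
    then have i2: "integrable M (\<lambda>t. \<bar>g n t - g' t\<bar>\<^sup>2)"
      by (simp add: power2_eq_square algebra_simps)
    show "(\<integral>t. \<bar>g n t - g' t\<bar> \<partial>M)\<^sup>2 \<le> (\<integral>t. (g n t - g' t)\<^sup>2 \<partial>M)"
      \<comment> \<open>The variance of \<open>\<bar>g n t - g' t\<bar>\<close> is nonnegative, so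
        the square of the mean is at most the mean of the square.\<close>
      using variance_eq[OF i i2] variance_positive[of "\<lambda>t. \<bar>g n t - g' t\<bar>"] by simp
  qed
  then show ?thesis
    by (intro tendsto_sandwich[OF _ _ tendsto_const lim]) (auto intro: integral_nonneg_AE)
qed

text \<open>The truncated distance from \<open>u n t\<close> to \<open>v t\<close> is estimated
  through the point among \<open>D 0, ..., D N\<close> closest to \<open>v t\<close>. This leaves a
  finite sum controlled by \<open>lim\<close> and a remainder that is small for large
  \<open>N\<close> by density.\<close>

lemma prob_dist_tendstoI:
  fixes u :: "nat \<Rightarrow> 'a \<Rightarrow> 'b::polish_space" and D :: "nat \<Rightarrow> 'b"
  assumes [measurable]: "\<And>n. u n \<in> borel_measurable M" "v \<in> borel_measurable M"
    and dense: "\<And>x e. 0 < e \<Longrightarrow> \<exists>j. dist x (D j) < e"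
    and lim: "\<And>j. (\<lambda>n. \<integral>t. \<bar>min 1 (dist (u n t) (D j)) - min 1 (dist (v t) (D j))\<bar> \<partial>M) \<longlonglongrightarrow> 0"
  shows "(\<lambda>n. prob_dist M (u n) v) \<longlonglongrightarrow> 0"
proof -
  define h where "h j x = min 1 (dist x (D j))" for j x
  have [measurable]: "(\<lambda>t. h j (u n t)) \<in> borel_measurable M" "(\<lambda>t. h j (v t)) \<in> borel_measurable M" for j n
    unfolding h_def by measurable
  have h01: "0 \<le> h j x" "h j x \<le> 1" for j x by (auto simp: h_def)
  have int: "integrable M (\<lambda>t. \<bar>h j (u n t) - h j (v t)\<bar>)" for j n
  proof (rule integrable_const_bound[of _ 1])
    have "\<bar>h j x - h j y\<bar> \<le> 1" for x y using h01[of j x] h01[of j y] by linarith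
    then show "AE t in M. norm \<bar>h j (u n t) - h j (v t)\<bar> \<le> 1" by simp
  qed measurable
  \<comment> \<open>The truncated distance from \<open>v t\<close> to the nearest of the first
    \<open>N + 1\<close> points of the dense sequence.\<close>
  define w where "w N t = Min ((\<lambda>j. h j (v t)) ` {..N})" for N t
  have "\<exists>j\<le>N. w N t = h j (v t)" for N t
  proof -
    have "w N t \<in> (\<lambda>j. h j (v t)) ` {..N}" unfolding w_def by (intro Min_in) auto
    then show ?thesis by auto
  qed
  note w_eq = this
  have w_le: "w N t \<le> h j (v t)" if "j \<le> N" for N j t
    unfolding w_def using that by (intro Min_le) auto
  have w01: "0 \<le> w N t" "w N t \<le> 1" for N t using w_eq[of N t] h01 by auto
  have w_Suc: "w (Suc N) = (\<lambda>t. min (h (Suc N) (v t)) (w N t))" for N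
    by (simp add: w_def atMost_Suc fun_eq_iff)
  have w_meas [measurable]: "w N \<in> borel_measurable M" for N
  proof (induction N)
    case 0
    then show ?case by (simp add: w_def[abs_def])
  next
    case (Suc N)
    then show ?case unfolding w_Suc by measurable
  qed
  have w_int: "integrable M (w N)" for N
    by (rule integrable_const_bound[of _ 1]) (use w01 in auto)
  have "(\<lambda>N. w N t) \<longlonglongrightarrow> 0" for t
  proof (rule tendstoI)
    fix e :: real assume "0 < e"
    then obtain j where "dist (v t) (D j) < e" using dense by blast
    then have "h j (v t) < e" by (simp add: h_def)
    then have "w N t < e" if "j \<le> N" for N using w_le[OF that, of t] by simp
    then show "\<forall>\<^sub>F N in sequentially. dist (w N t) 0 < e"
      using w01 by (auto simp: eventually_sequentially)
  qed
  then have "(\<lambda>N. \<integral>t. w N t \<partial>M) \<longlonglongrightarrow> (\<integral>t. 0 \<partial>M)"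
    by (intro integral_dominated_convergence[where w="\<lambda>_. 1"]) (use w01 in auto)
  then have w_lim: "(\<lambda>N. \<integral>t. w N t \<partial>M) \<longlonglongrightarrow> 0" by simp
  \<comment> \<open>The minimizing \<open>j\<close> depends on \<open>t\<close>, so its single term
    is replaced by the sum over all \<open>j \<le> N\<close> before integrating.\<close>
  have "min 1 (dist x (v t)) \<le> (\<Sum>j\<le>N. \<bar>h j x - h j (v t)\<bar>) + 2 * w N t" for x N t
  proof -
    obtain j where j: "j \<le> N" "w N t = h j (v t)" using w_eq by blast
    have "min 1 (dist x (v t)) \<le> h j x + h j (v t)"
      using dist_triangle2[of x "v t" "D j"] zero_le_dist[of x "D j"] zero_le_dist[of "v t" "D j"]
      unfolding h_def min_def by (smt (verit))
    also have "\<dots> \<le> \<bar>h j x - h j (v t)\<bar> + 2 * w N t" using j by simp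
    also have "\<bar>h j x - h j (v t)\<bar> \<le> (\<Sum>j\<le>N. \<bar>h j x - h j (v t)\<bar>)"
      using j by (intro member_le_sum) auto
    finally show ?thesis by simp
  qed
  note bound = this
  have le: "prob_dist M (u n) v \<le>
      (\<Sum>j\<le>N. \<integral>t. \<bar>h j (u n t) - h j (v t)\<bar> \<partial>M) + 2 * (\<integral>t. w N t \<partial>M)" for n N
  proof -
    have "prob_dist M (u n) v \<le> (\<integral>t. (\<Sum>j\<le>N. \<bar>h j (u n t) - h j (v t)\<bar>) + 2 * w N t \<partial>M)"
      unfolding prob_dist_def
      by (rule integral_mono[OF integrable_min_one_dist _ bound])
        (auto intro!: Bochner_Integration.integrable_add Bochner_Integration.integrable_sum int w_int)
    also have "\<dots> = (\<integral>t. (\<Sum>j\<le>N. \<bar>h j (u n t) - h j (v t)\<bar>) \<partial>M) + (\<integral>t. 2 * w N t \<partial>M)"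
      by (rule Bochner_Integration.integral_add)
        (auto intro!: Bochner_Integration.integrable_sum int w_int)
    also have "\<dots> = (\<Sum>j\<le>N. \<integral>t. \<bar>h j (u n t) - h j (v t)\<bar> \<partial>M) + 2 * (\<integral>t. w N t \<partial>M)"
      by (subst Bochner_Integration.integral_sum[OF int]) simp
    finally show ?thesis .
  qed
  show ?thesis
  proof (rule tendstoI)
    fix e :: real assume e: "0 < e"
    \<comment> \<open>\<open>N\<close> is fixed first. The remainder enters with factor 2, so
      \<open>e/4\<close> leaves \<open>e/2\<close> for the finite sum as \<open>n\<close>
      grows.\<close>
    from order_tendstoD(2)[OF w_lim, of "e/4"] e obtain N where N: "(\<integral>t. w N t \<partial>M) < e/4"
      by (auto simp: eventually_sequentially)
    have "(\<lambda>n. \<Sum>j\<le>N. \<integral>t. \<bar>h j (u n t) - h j (v t)\<bar> \<partial>M) \<longlonglongrightarrow> 0"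
      using lim unfolding h_def by (intro tendsto_null_sum)
    from order_tendstoD(2)[OF this, of "e/2"] e
    have "\<forall>\<^sub>F n in sequentially. (\<Sum>j\<le>N. \<integral>t. \<bar>h j (u n t) - h j (v t)\<bar> \<partial>M) < e/2" by simp
    then show "\<forall>\<^sub>F n in sequentially. dist (prob_dist M (u n) v) 0 < e"
    proof eventually_elim
      case (elim n)
      with le[of n N] N prob_dist_nonneg[of M "u n" v] show ?case by simp
    qed
  qed
qed

end

section \<open>The space of controls\<close>

text \<open>The exponential distribution of rate 1 on the half-line. It is the common time marginal
  of all control measures, which are its images under graphs.\<close>

definition exp_measure :: "real measure" where
  "exp_measure = density (restrict_space lborel {0..}) (\<lambda>t. ennreal (exp (- t)))"

lemma sets_exp_measure [measurable_cong]: "sets exp_measure = sets (restrict_space borel {0..})"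
  unfolding exp_measure_def sets_density by (intro sets_restrict_space_cong) simp

lemma space_exp_measure [simp]: "space exp_measure = {0..}"
  by (simp add: exp_measure_def space_restrict_space)

lemma L0_funs_eq: "L0_funs = borel_measurable exp_measure"
  unfolding L0_funs_def by (rule measurable_cong_sets[symmetric]) (simp_all add: sets_exp_measure)

lemma control_measure_eq:
  "u \<in> L0_funs \<Longrightarrow> control_measure u = distr exp_measure (restrict_space borel half_strip) (\<lambda>t. (t, u t))"
  unfolding exp_measure_def by (rule control_measure_eq_distr)

lemma graph_measurable_exp_measure:
  "u \<in> L0_funs \<Longrightarrow> (\<lambda>t. (t, u t)) \<in> exp_measure \<rightarrow>\<^sub>M restrict_space borel half_strip"
  using graph_measurable by (simp add: measurable_cong_sets[OF sets_exp_measure refl])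

text \<open>A measure has total mass 1 as soon as one of its images does; here the image is the
  control measure of the zero function.\<close>

lemma prob_space_exp_measure: "prob_space exp_measure"
proof -
  have "(\<lambda>_. 0 :: real) \<in> L0_funs" by (simp add: L0_funs_def)
  then show ?thesis
    using control_measure_in_prob_measures prob_space_distrD[OF graph_measurable_exp_measure]
    by (fastforce simp: control_measure_eq prob_measures_def)
qed

interpretation E: prob_space exp_measure
  by (rule prob_space_exp_measure)

text \<open>The density is strictly positive and the point 0 is Lebesgue null, so equality almost
  everywhere for \<open>exp_measure\<close> is the relation \<open>ae_rel\<close>.\<close>

lemma AE_exp_measure_iff: "(AE t in exp_measure. P t) \<longleftrightarrow> (AE t in lborel. 0 < t \<longrightarrow> P t)"
proof -
  have "(\<lambda>t::real. ennreal (exp (- t))) \<in> borel_measurable (restrict_space lborel {0..})"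
    by (intro measurable_restrict_space1) simp
  then have "(AE t in exp_measure. P t) \<longleftrightarrow> (AE t in lborel. 0 \<le> t \<longrightarrow> P t)"
    unfolding exp_measure_def by (subst AE_density) (auto simp: AE_restrict_space_iff)
  also have "\<dots> \<longleftrightarrow> (AE t in lborel. 0 < t \<longrightarrow> P t)"
    using AE_lborel_singleton[of "0::real"] by (intro eventually_subst) (auto elim: eventually_mono)
  finally show ?thesis .
qed

lemma integral_control_measure:
  fixes f :: "real \<times> 'u::polish_space \<Rightarrow> real"
  assumes "u \<in> L0_funs" "f \<in> borel_measurable (restrict_space borel half_strip)"
  shows "(\<integral>x. f x \<partial>control_measure u) = (\<integral>t. f (t, u t) \<partial>exp_measure)"
  using integral_distr[OF graph_measurable_exp_measure assms(2)] assms(1)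
  by (simp add: control_measure_eq)

section \<open>The complete metric on classes, and its comparison with the sharp topology\<close>

definition L0_rep :: "(real \<Rightarrow> 'u::polish_space) set \<Rightarrow> real \<Rightarrow> 'u" where
  "L0_rep c = (SOME u. u \<in> c)"

text \<open>The choice of representatives does not affect the value, by
  \<open>E.prob_dist_cong_AE\<close>.\<close>

definition L0_dist :: "(real \<Rightarrow> 'u::polish_space) set \<Rightarrow> (real \<Rightarrow> 'u) set \<Rightarrow> real" where
  "L0_dist c c' = prob_dist exp_measure (L0_rep c) (L0_rep c')"

lemma L0_rep_in:
  assumes "c \<in> L0"
  shows "L0_rep c \<in> c"
proof -
  have "\<exists>u. u \<in> c"
    using assms equiv_class_self[OF equiv_ae_rel] unfolding L0_def by (auto elim!: quotientE)
  then show ?thesis unfolding L0_rep_def by (rule someI_ex)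
qed

lemma L0_rep_L0_funs: "c \<in> L0 \<Longrightarrow> L0_rep c \<in> L0_funs"
  using L0_rep_in in_quotient_imp_subset[OF equiv_ae_rel] unfolding L0_def by blast

lemma L0_rep_measurable: "c \<in> L0 \<Longrightarrow> L0_rep c \<in> borel_measurable exp_measure"
  using L0_rep_L0_funs by (simp add: L0_funs_eq)

lemma L0_eq_iff:
  assumes "c \<in> L0" "c' \<in> L0"
  shows "c = c' \<longleftrightarrow> (AE t in exp_measure. L0_rep c t = L0_rep c' t)"
proof -
  have "c = c' \<longleftrightarrow> (L0_rep c, L0_rep c') \<in> ae_rel"
    using assms unfolding L0_def
    by (intro quotient_eq_iff[OF equiv_ae_rel]) (auto intro: L0_rep_in simp: L0_def)
  then show ?thesis
    using assms by (simp add: ae_rel_def L0_rep_L0_funs AE_exp_measure_iff)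
qed

lemma L0_class:
  assumes "u \<in> L0_funs"
  shows "ae_rel `` {u} \<in> L0" "AE t in exp_measure. L0_rep (ae_rel `` {u}) t = u t"
proof -
  show L: "ae_rel `` {u} \<in> L0" unfolding L0_def by (rule quotientI[OF assms])
  from L0_rep_in[OF this] show "AE t in exp_measure. L0_rep (ae_rel `` {u}) t = u t"
    unfolding AE_exp_measure_iff by (auto simp: ae_rel_def eq_commute)
qed

lemma L0_embed_in_prob_measures: "c \<in> L0 \<Longrightarrow> L0_embed c \<in> prob_measures"
  using L0_embed_eq L0_rep_in control_measure_in_prob_measures L0_rep_L0_funs by metis

lemma integral_L0_embed:
  fixes f :: "real \<times> 'u::polish_space \<Rightarrow> real"
  assumes "c \<in> L0" "continuous_on half_strip f"
  shows "(\<integral>x. f x \<partial>L0_embed c) = (\<integral>t. f (t, L0_rep c t) \<partial>exp_measure)"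
  by (simp add: L0_embed_eq[OF assms(1) L0_rep_in[OF assms(1)]] integral_control_measure
      L0_rep_L0_funs assms borel_measurable_continuous_on_restrict)

lemma Metric_space_L0: "Metric_space L0 L0_dist"
  by unfold_locales
    (simp_all add: L0_dist_def prob_dist_nonneg prob_dist_commute L0_eq_iff
      E.prob_dist_eq_0_iff E.prob_dist_triangle L0_rep_measurable)

text \<open>A subsequence of the representatives converges to some measurable \<open>v\<close>; the
  class of \<open>v\<close> is then the limit of that subsequence, and a Cauchy sequence with a
  convergent subsequence converges.\<close>

lemma mcomplete_L0: "Metric_space.mcomplete (L0 :: (real \<Rightarrow> 'u::polish_space) set set) L0_dist"
proof -
  interpret Metric_space "L0 :: (real \<Rightarrow> 'u) set set" L0_dist by (rule Metric_space_L0)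
  show ?thesis
    unfolding mcomplete_def
  proof (intro allI impI)
    fix \<sigma> :: "nat \<Rightarrow> (real \<Rightarrow> 'u) set" assume \<sigma>: "MCauchy \<sigma>"
    then have L: "\<sigma> n \<in> L0" for n by (auto simp: MCauchy_def)
    have Cauchy: "\<exists>K. \<forall>m\<ge>K. \<forall>n\<ge>K. prob_dist exp_measure (L0_rep (\<sigma> m)) (L0_rep (\<sigma> n)) < e"
      if "0 < e" for e
      using \<sigma> that unfolding MCauchy_def L0_dist_def by meson
    obtain r v where r: "strict_mono r" and v: "v \<in> borel_measurable exp_measure"
      and lim: "(\<lambda>n. prob_dist exp_measure (L0_rep (\<sigma> (r n))) v) \<longlonglongrightarrow> 0"
      by (rule E.prob_dist_complete[OF L0_rep_measurable[OF L] Cauchy])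
    define c where "c = ae_rel `` {v}"
    have c: "c \<in> L0" and ae: "AE t in exp_measure. L0_rep c t = v t"
      using L0_class v by (auto simp: L0_funs_eq c_def)
    have "L0_dist (\<sigma> (r n)) c = prob_dist exp_measure (L0_rep (\<sigma> (r n))) v" for n
      unfolding L0_dist_def using ae
      by (intro E.prob_dist_cong_AE) (auto simp: L0_rep_measurable L c v)
    with lim have lim: "(\<lambda>n. L0_dist (\<sigma> (r n)) c) \<longlonglongrightarrow> 0" by simp
    have "limitin mtopology (\<sigma> \<circ> r) c sequentially"
      unfolding limitin_metric using order_tendstoD(2)[OF lim] by (auto simp: L c)
    from MCauchy_convergent_subsequence[OF \<sigma> r this]
    show "\<exists>c. limitin mtopology \<sigma> c sequentially" ..
  qed
qed

lemma continuous_map_L0_integral: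
  fixes f :: "real \<times> 'u::polish_space \<Rightarrow> real"
  assumes f: "continuous_on half_strip f" and "bounded (f ` half_strip)"
  shows "continuous_map (Metric_space.mtopology L0 L0_dist) euclidean (\<lambda>c. \<integral>x. f x \<partial>L0_embed c)"
proof -
  interpret Metric_space "L0 :: (real \<Rightarrow> 'u) set set" L0_dist by (rule Metric_space_L0)
  obtain B where B: "\<bar>f x\<bar> \<le> B" if "x \<in> half_strip" for x
    using assms(2) unfolding bounded_iff by auto
  have meas: "(\<lambda>t. f (t, L0_rep c t)) \<in> borel_measurable exp_measure" if "c \<in> L0" for c
    using measurable_compose[OF graph_measurable_exp_measure borel_measurable_continuous_on_restrict[OF f]]
      L0_rep_L0_funs[OF that] by blast
  show ?thesis
  proof (rule continuous_map_euclideanI)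
    fix \<sigma> :: "nat \<Rightarrow> (real \<Rightarrow> 'u) set" and c
    assume \<sigma>: "range \<sigma> \<subseteq> L0" and c: "c \<in> L0" and lim: "(\<lambda>n. L0_dist (\<sigma> n) c) \<longlonglongrightarrow> 0"
    then have L: "\<sigma> n \<in> L0" for n by auto
    have "(\<lambda>n. \<integral>t. f (t, L0_rep (\<sigma> n) t) \<partial>exp_measure) \<longlonglongrightarrow> (\<integral>t. f (t, L0_rep c t) \<partial>exp_measure)"
    proof (rule E.prob_dist_tendsto_imp_integral_tendsto[where F="\<lambda>t x. f (t, x)" and B=B])
      show "(\<lambda>n. prob_dist exp_measure (L0_rep (\<sigma> n)) (L0_rep c)) \<longlonglongrightarrow> 0"
        using lim by (simp add: L0_dist_def)
      show "\<bar>f (t, x)\<bar> \<le> B" if "t \<in> space exp_measure" for t x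
        using that by (intro B) (simp add: half_strip_def)
      show "continuous_on UNIV (\<lambda>x. f (t, x))" if "t \<in> space exp_measure" for t
        using that by (intro continuous_on_compose2[OF f] continuous_intros) (auto simp: half_strip_def)
    qed (use L c meas L0_rep_measurable in auto)
    then show "(\<lambda>n. \<integral>x. f x \<partial>L0_embed (\<sigma> n)) \<longlonglongrightarrow> (\<integral>x. f x \<partial>L0_embed c)"
      by (simp add: integral_L0_embed L c f)
  qed
qed

text \<open>The metric topology refines the sharp one: the weak topology is generated by preimages
  under integrals, and these are continuous for the metric by
  \<open>continuous_map_L0_integral\<close>.\<close>

lemma continuous_map_L0_sharp:
  "continuous_map (Metric_space.mtopology L0 L0_dist) (sharp_topology :: (real \<Rightarrow> 'u::polish_space) set topology) id"
proof -
  interpret Metric_space "L0 :: (real \<Rightarrow> 'u) set set" L0_dist by (rule Metric_space_L0)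
  have "continuous_map mtopology weak_topology (L0_embed :: (real \<Rightarrow> 'u) set \<Rightarrow> _)"
    unfolding weak_topology_def
  proof (rule continuous_on_generated_topo, elim CollectE exE conjE)
    fix U and f :: "real \<times> 'u \<Rightarrow> real" and V
    assume U: "U = {\<mu> \<in> prob_measures. (\<integral>x. f x \<partial>\<mu>) \<in> V}"
      and f: "continuous_on half_strip f" "bounded (f ` half_strip)" and V: "open V"
    have "L0_embed -` U \<inter> topspace mtopology = {c \<in> topspace mtopology. (\<integral>x. f x \<partial>L0_embed c) \<in> V}"
      using L0_embed_in_prob_measures by (auto simp: U)
    then show "openin mtopology (L0_embed -` U \<inter> topspace mtopology)"
      using openin_continuous_map_preimage[OF continuous_map_L0_integral[OF f]] V by simp
  next
    show "L0_embed ` topspace mtopology \<subseteq> \<Union> {{\<mu> \<in> prob_measures. (\<integral>x. f x \<partial>\<mu>) \<in> V} | (f :: real \<times> 'u \<Rightarrow> real) V.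
        continuous_on half_strip f \<and> bounded (f ` half_strip) \<and> open V}"
      using L0_embed_in_prob_measures topspace_weak_topology[where 'u='u]
      unfolding weak_topology_def topology_generated_by_topspace by auto
  qed
  then have "openin mtopology {c \<in> L0. c \<in> S}" if "openin sharp_topology S" for S :: "(real \<Rightarrow> 'u) set set"
  proof -
    from that obtain U where U: "openin weak_topology U" "S = L0_embed -` U \<inter> L0"
      unfolding sharp_topology_def openin_pullback_topology by blast
    then show ?thesis
      using openin_continuous_map_preimage[OF \<open>continuous_map mtopology weak_topology L0_embed\<close> U(1)]
      by (simp add: vimage_def Int_def conj_commute)
  qed
  then show ?thesis
    by (auto simp: continuous_map_def topspace_sharp_topology)
qed

text \<open>Preimages of open sets are pulled back from generators of the weak topology. This makes
  each coordinate in \<open>L0_coords\<close> continuous.\<close>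

lemma continuous_map_sharp_integral:
  fixes f :: "real \<times> 'u::polish_space \<Rightarrow> real"
  assumes "continuous_on half_strip f" "bounded (f ` half_strip)"
  shows "continuous_map sharp_topology euclidean (\<lambda>c. \<integral>x. f x \<partial>L0_embed c)"
  unfolding continuous_map_def
proof (intro conjI allI impI)
  fix V :: "real set" assume V: "openin euclidean V"
  have "openin weak_topology {\<mu> \<in> prob_measures. (\<integral>x. f x \<partial>\<mu>) \<in> V}"
    unfolding weak_topology_def by (rule topology_generated_by_Basis) (use assms V in auto)
  moreover have "{c \<in> topspace sharp_topology. (\<integral>x. f x \<partial>L0_embed c) \<in> V} =
      L0_embed -` {\<mu> \<in> prob_measures. (\<integral>x. f x \<partial>\<mu>) \<in> V} \<inter> L0"
    using L0_embed_in_prob_measures by (auto simp: topspace_sharp_topology)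
  ultimately show "openin sharp_topology {c \<in> topspace sharp_topology. (\<integral>x. f x \<partial>L0_embed c) \<in> V}"
    unfolding sharp_topology_def openin_pullback_topology by blast
qed simp

section \<open>Coordinates given by test functions\<close>

text \<open>One natural number codes both countable families: \<open>Some q\<close> selects the
  products used for weak limits, \<open>None\<close> the squares used for norms. The hinge in time
  takes the place of an indicator, which would not be continuous.\<close>

definition test_fun :: "(nat \<Rightarrow> 'u::polish_space) \<Rightarrow> nat \<Rightarrow> real \<times> 'u \<Rightarrow> real" where
  "test_fun D k p = (case from_nat k of
     (Some q, j) \<Rightarrow> max 0 (of_rat q - fst p) * min 1 (dist (snd p) (D j))
   | (None, j) \<Rightarrow> (min 1 (dist (snd p) (D j)))\<^sup>2)"

lemma test_fun_Some: "test_fun D (to_nat (Some q, j)) (t, x) = max 0 (of_rat q - t) * min 1 (dist x (D j))"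
  and test_fun_None: "test_fun D (to_nat (None :: rat option, j)) (t, x) = (min 1 (dist x (D j)))\<^sup>2"
  by (simp_all add: test_fun_def)

lemma continuous_on_test_fun: "continuous_on A (test_fun D k)"
proof -
  obtain q j where k: "(from_nat k :: rat option \<times> nat) = (q, j)" by fastforce
  show ?thesis
    by (cases q) (auto simp: test_fun_def[abs_def] k intro!: continuous_intros)
qed

lemma bounded_test_fun: "bounded (test_fun D k ` half_strip)"
proof -
  obtain q j where k: "(from_nat k :: rat option \<times> nat) = (q, j)" by fastforce
  have *: "max 0 (r - t) * min 1 d \<le> max 0 r" if "0 \<le> t" "0 \<le> d" for r t d :: real
  proof -
    have "max 0 (r - t) * min 1 d \<le> max 0 (r - t) * 1"
      using that by (intro mult_mono) auto
    also have "\<dots> \<le> max 0 r" using that by simp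
    finally show ?thesis .
  qed
  show ?thesis
  proof (cases q)
    case None
    then show ?thesis
      unfolding bounded_iff
      by (intro exI[of _ 1]) (auto simp: test_fun_def k power_le_one)
  next
    case (Some r)
    then show ?thesis
      unfolding bounded_iff
      by (intro exI[of _ "max 0 (of_rat r)"]) (auto simp: test_fun_def k half_strip_def intro!: *)
  qed
qed

text \<open>The traces of the rays \<open>{..a}\<close> form the pi-system to which
  \<open>weak_limit_from_generator\<close> is applied.\<close>

lemma sets_exp_measure_generator:
  "sets exp_measure = sigma_sets (space exp_measure) (range (\<lambda>a. {0..} \<inter> {..a}))"
proof -
  have b: "sets (borel :: real measure) = sigma_sets UNIV (range (\<lambda>a. {..a}))"
    by (subst borel_eq_atMost) simp
  have "({0..} :: real set) \<in> sigma_sets UNIV (range (\<lambda>a. {..a}))"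
    unfolding b[symmetric] by simp
  from sigma_sets_Int[OF this] show ?thesis
    by (simp add: sets_exp_measure sets_restrict_space b image_image)
qed

text \<open>The functions \<open>t \<mapsto> max 0 (a - t)\<close> are continuous and bounded on the half-line, and the
  difference quotients in \<open>a\<close> converge to the indicator of \<open>{..a}\<close>.\<close>

lemma weak_limit_exp_measure:
  fixes g :: "nat \<Rightarrow> real \<Rightarrow> real"
  assumes g: "\<And>n. g n \<in> borel_measurable exp_measure" "\<And>n t. \<bar>g n t\<bar> \<le> 1"
    and g': "g' \<in> borel_measurable exp_measure" "\<And>t. \<bar>g' t\<bar> \<le> 1"
    and lim: "\<And>q :: rat. (\<lambda>n. \<integral>t. max 0 (of_rat q - t) * g n t \<partial>exp_measure)
      \<longlonglongrightarrow> (\<integral>t. max 0 (of_rat q - t) * g' t \<partial>exp_measure)"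
    and f: "integrable exp_measure f"
  shows "(\<lambda>n. \<integral>t. f t * g n t \<partial>exp_measure) \<longlonglongrightarrow> (\<integral>t. f t * g' t \<partial>exp_measure)"
proof -
  have hinge_meas [measurable]: "(\<lambda>t. max 0 (a - t)) \<in> borel_measurable exp_measure" for a :: real
    by (intro borel_measurable_max borel_measurable_diff borel_measurable_const)
      (simp add: measurable_cong_sets[OF sets_exp_measure refl] measurable_restrict_space1)
  have hinge_int: "integrable exp_measure (\<lambda>t. max 0 (a - t))" for a :: real
    by (rule E.integrable_const_bound[of _ "\<bar>a\<bar>"]) (auto simp: AE_exp_measure_iff)
  \<comment> \<open>From rational to real \<open>a\<close>: rationals \<open>q i\<close> decrease to
    \<open>a\<close> within \<open>1 / Suc i\<close>, and on the half-line their hinges are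
    dominated by the constant \<open>\<bar>a\<bar> + 1\<close>.\<close>
  have hinge: "(\<lambda>n. \<integral>t. max 0 (a - t) * g n t \<partial>exp_measure) \<longlonglongrightarrow> (\<integral>t. max 0 (a - t) * g' t \<partial>exp_measure)"
    for a :: real
  proof -
    have "\<exists>q :: rat. a < of_rat q \<and> of_rat q < a + 1 / Suc i" for i
      by (rule of_rat_dense) simp
    then obtain q :: "nat \<Rightarrow> rat" where q: "\<And>i. a < of_rat (q i)" "\<And>i. of_rat (q i) < a + 1 / Suc i"
      by metis
    have "(\<lambda>i. real_of_rat (q i)) \<longlonglongrightarrow> a"
    proof (rule tendsto_sandwich[where f="\<lambda>_. a"])
      show "(\<lambda>i. a + 1 / Suc i) \<longlonglongrightarrow> a"
        using tendsto_add[OF tendsto_const LIMSEQ_inverse_real_of_nat, of a] by (simp add: inverse_eq_divide)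
      show "\<forall>\<^sub>F i in sequentially. a \<le> of_rat (q i)"
        using q(1) by (simp add: less_imp_le)
      show "\<forall>\<^sub>F i in sequentially. of_rat (q i) \<le> a + 1 / Suc i"
        using q(2) by (intro always_eventually allI less_imp_le)
    qed simp
    note q_lim = this
    have q_le: "\<bar>max 0 (of_rat (q i) - t)\<bar> \<le> \<bar>a\<bar> + 1" if "0 \<le> t" for i t
    proof -
      have "1 / real (Suc i) \<le> 1" by simp
      with q(2)[of i] that have "of_rat (q i) - t \<le> \<bar>a\<bar> + 1" by linarith
      then show ?thesis by simp
    qed
    show ?thesis
    proof (rule E.weak_limit_dominated[OF g g', where s="\<lambda>i t. max 0 (of_rat (q i) - t)" and w="\<lambda>_. \<bar>a\<bar> + 1"])
      show "(\<lambda>i. max 0 (real_of_rat (q i) - t)) \<longlonglongrightarrow> max 0 (a - t)" for t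
        by (intro tendsto_intros q_lim)
    qed (use lim hinge_int q_le in auto)
  qed
  have ind_int: "integrable exp_measure (indicator A :: real \<Rightarrow> real)" if "A \<in> sets exp_measure" for A
    using that by (intro integrable_real_indicator) (simp_all add: less_top[symmetric])
  have ray_sets: "{0..} \<inter> {..a} \<in> sets exp_measure" for a :: real
    by (simp add: sets_exp_measure sets_restrict_space)
  have ray: "(\<lambda>n. \<integral>t. indicator ({0..} \<inter> {..a}) t * g n t \<partial>exp_measure)
      \<longlonglongrightarrow> (\<integral>t. indicator ({0..} \<inter> {..a}) t * g' t \<partial>exp_measure)" for a :: real
  proof -
    \<comment> \<open>The forward difference quotient of the hinge with step
      \<open>1 / Suc i\<close>: it equals 1 up to and including \<open>a\<close>, vanishes beyond
      \<open>a + 1 / Suc i\<close> and lies between 0 and 1. Its limit is therefore the indicator of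
      the closed ray.\<close>
    define s where "s i t = real (Suc i) * max 0 (a + 1 / Suc i - t) - real (Suc i) * max 0 (a - t)" for i t
    have eq: "(\<integral>t. s i t * h t \<partial>exp_measure) = real (Suc i) * (\<integral>t. max 0 (a + 1 / Suc i - t) * h t \<partial>exp_measure)
        - real (Suc i) * (\<integral>t. max 0 (a - t) * h t \<partial>exp_measure)"
      if h: "h \<in> borel_measurable exp_measure" "\<And>t. \<bar>h t\<bar> \<le> 1" for h :: "real \<Rightarrow> real" and i
      unfolding s_def
      by (simp del: of_nat_Suc add: left_diff_distrib mult.assoc E.integrable_mult_unit_bounded[OF hinge_int h])
    have s_pos: "s i t = 1" if "t \<le> a" for i t
    proof -
      have "max 0 (a + 1 / Suc i - t) = (a - t) + 1 / Suc i" "max 0 (a - t) = a - t"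
        using that add_increasing2[of "1 / real (Suc i)" t a] by (auto simp: max_absorb2 simp del: of_nat_Suc)
      then show ?thesis by (simp add: s_def distrib_left del: of_nat_Suc)
    qed
    have s_neg: "s i t = real (Suc i) * max 0 (a + 1 / Suc i - t)" if "a < t" for i t
      using that by (simp add: s_def)
    have s_bound: "\<bar>s i t\<bar> \<le> 1" for i t
    proof (cases "t \<le> a")
      case False
      then have "real (Suc i) * max 0 (a + 1 / Suc i - t) \<le> real (Suc i) * (1 / Suc i)"
        by (intro mult_left_mono) auto
      with False show ?thesis by (simp add: s_neg)
    qed (simp add: s_pos)
    show ?thesis
    proof (rule E.weak_limit_dominated[OF g g', where s=s and w="\<lambda>_. 1"])
      show "integrable exp_measure (s i)" for i
        unfolding s_def[abs_def]
        by (intro Bochner_Integration.integrable_diff integrable_mult_right hinge_int)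
      show "(\<lambda>n. \<integral>t. s i t * g n t \<partial>exp_measure) \<longlonglongrightarrow> (\<integral>t. s i t * g' t \<partial>exp_measure)" for i
        unfolding eq[OF g] eq[OF g'] by (intro tendsto_diff tendsto_mult_left hinge)
      show "(\<lambda>i. s i t) \<longlonglongrightarrow> indicator ({0..} \<inter> {..a}) t" if "t \<in> space exp_measure" for t
      proof (cases "t \<le> a")
        case True
        with that show ?thesis by (simp add: s_pos)
      next
        case False
        then obtain N where N: "1 / real (Suc N) < t - a"
          using nat_approx_posE[of "t - a"] by auto
        have "s i t = 0" if "N \<le> i" for i
        proof -
          have "1 / real (Suc i) \<le> 1 / real (Suc N)" using that by (intro divide_left_mono) auto
          with N False show ?thesis by (simp add: s_neg del: of_nat_Suc)
        qed
        then have "\<forall>\<^sub>F i in sequentially. s i t = 0" by (auto simp: eventually_sequentially)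
        with False show ?thesis by (simp add: tendsto_eventually)
      qed
    qed (use s_bound ind_int[OF ray_sets] in auto)
  qed
  \<comment> \<open>The sets \<open>{0..} \<inter> {..real i}\<close> exhaust the half-line, which
    gives the limit over the whole space.\<close>
  have "(\<lambda>n. \<integral>t. 1 * g n t \<partial>exp_measure) \<longlonglongrightarrow> (\<integral>t. 1 * g' t \<partial>exp_measure)"
  proof (rule E.weak_limit_dominated[OF g g', where s="\<lambda>i. indicator ({0..} \<inter> {..real i})" and w="\<lambda>_. 1"])
    show "(\<lambda>i. indicator ({0..} \<inter> {..real i}) t :: real) \<longlonglongrightarrow> 1" if "t \<in> space exp_measure" for t
    proof -
      obtain N where "t \<le> real N" using real_arch_simple by blast
      then have "\<forall>\<^sub>F i in sequentially. indicator ({0..} \<inter> {..real i}) t = (1 :: real)"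
        using that by (auto simp: eventually_sequentially indicator_def intro!: exI[of _ N])
      then show ?thesis by (rule tendsto_eventually)
    qed
  qed (use ray ind_int[OF ray_sets] in \<open>auto simp: indicator_def\<close>)
  then have whole: "(\<lambda>n. \<integral>t. g n t \<partial>exp_measure) \<longlonglongrightarrow> (\<integral>t. g' t \<partial>exp_measure)" by simp
  have "Int_stable (range (\<lambda>a::real. {0..} \<inter> {..a}))"
  proof (rule Int_stableI_image)
    show "\<exists>c\<in>UNIV. ({0..} \<inter> {..a}) \<inter> ({0..} \<inter> {..b}) = {0..} \<inter> {..c}" for a b :: real
      by (rule bexI[of _ "min a b"]) auto
  qed
  from E.weak_limit_from_generator[OF g g' sets_exp_measure_generator this _ _ whole f] show ?thesis
    using ray by auto
qed

definition L0_coords :: "(nat \<Rightarrow> 'u::polish_space) \<Rightarrow> (real \<Rightarrow> 'u) set \<Rightarrow> nat \<Rightarrow> real" where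
  "L0_coords D c k = (\<integral>x. test_fun D k x \<partial>L0_embed c)"

text \<open>For each \<open>j\<close>, the \<open>Some\<close> coordinates give the weak limit of
  the truncated distances to \<open>D j\<close> and the \<open>None\<close> coordinate their L2
  norms. Hence these distances converge in L1, as \<open>E.prob_dist_tendstoI\<close>
  requires.\<close>

lemma L0_coords_tendsto_imp_L0_dist_tendsto:
  fixes D :: "nat \<Rightarrow> 'u::polish_space"
  assumes dense: "\<And>x e. 0 < e \<Longrightarrow> \<exists>j. dist x (D j) < e"
    and c: "\<And>n. c n \<in> L0" "c' \<in> L0"
    and lim: "\<And>k. (\<lambda>n. L0_coords D (c n) k) \<longlonglongrightarrow> L0_coords D c' k"
  shows "(\<lambda>n. L0_dist (c n) c') \<longlonglongrightarrow> 0"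
  unfolding L0_dist_def
proof (rule E.prob_dist_tendstoI[OF _ _ dense])
  note [measurable] = L0_rep_measurable[OF c(1)] L0_rep_measurable[OF c(2)]
  note lim = lim[unfolded L0_coords_def integral_L0_embed[OF c(1) continuous_on_test_fun]
      integral_L0_embed[OF c(2) continuous_on_test_fun]]
  fix j
  let ?h = "\<lambda>c t. min 1 (dist (L0_rep c t) (D j))"
  have meas: "?h (c n) \<in> borel_measurable exp_measure" "?h c' \<in> borel_measurable exp_measure" for n
    by measurable
  have bound: "\<bar>?h c t\<bar> \<le> 1" for c t by simp
  have int: "integrable exp_measure (?h c')"
    by (rule E.integrable_const_bound[of _ 1]) (use meas in auto)
  show "(\<lambda>n. \<integral>t. \<bar>?h (c n) t - ?h c' t\<bar> \<partial>exp_measure) \<longlonglongrightarrow> 0"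
  proof (rule E.weak_and_norm_limit_imp_L1[OF meas(1) bound meas(2) bound])
    show "(\<lambda>n. \<integral>t. ?h c' t * ?h (c n) t \<partial>exp_measure) \<longlonglongrightarrow> (\<integral>t. ?h c' t * ?h c' t \<partial>exp_measure)"
    \<comment> \<open>The weak limit is tested against the limit function \<open>?h c'\<close>
      itself, which yields the cross term of the expanded square.\<close>
    proof (rule weak_limit_exp_measure[OF meas(1) bound meas(2) bound _ int])
      show "(\<lambda>n. \<integral>t. max 0 (of_rat q - t) * ?h (c n) t \<partial>exp_measure)
          \<longlonglongrightarrow> (\<integral>t. max 0 (of_rat q - t) * ?h c' t \<partial>exp_measure)" for q
        using lim[of "to_nat (Some q, j)"] by (simp only: test_fun_Some)
    qed
    show "(\<lambda>n. \<integral>t. (?h (c n) t)\<^sup>2 \<partial>exp_measure) \<longlonglongrightarrow> (\<integral>t. (?h c' t)\<^sup>2 \<partial>exp_measure)"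
      using lim[of "to_nat (None :: rat option, j)"] by (simp only: test_fun_None)
  qed
qed (use c L0_rep_measurable in auto)

lemma dense_sequence:
  obtains D :: "nat \<Rightarrow> 'u::polish_space" where "\<forall>x. \<forall>e>0. \<exists>j. dist x (D j) < e"
proof -
  obtain A :: "'u set" where A: "countable A" "\<And>X. open X \<Longrightarrow> X \<noteq> {} \<Longrightarrow> \<exists>d\<in>A. d \<in> X"
    by (rule countable_dense_setE) blast
  from A(2)[of UNIV] have "A \<noteq> {}" by auto
  have "\<exists>j. dist x (from_nat_into A j) < e" if e: "0 < e" for x e
  proof -
    obtain d where "d \<in> A" "dist x d < e"
      using A(2)[of "ball x e"] e by auto
    then show ?thesis using from_nat_into_surj[OF A(1), of d] by auto
  qed
  then have "\<forall>x. \<forall>e>0. \<exists>j. dist x (from_nat_into A j) < e" by simp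
  then show thesis by (rule that)
qed

section \<open>The coordinate embedding and its Borel image\<close>

theorem lemma1p2:
  shows "is_borel_space (sharp_topology :: (real \<Rightarrow> 'u::polish_space) set topology)"
proof -
  obtain D :: "nat \<Rightarrow> 'u" where "\<forall>x. \<forall>e>0. \<exists>j. dist x (D j) < e"
    by (rule dense_sequence)
  then have dense: "\<exists>j. dist x (D j) < e" if "0 < e" for x e
    using that by blast
  interpret Metric_space "L0 :: (real \<Rightarrow> 'u) set set" L0_dist by (rule Metric_space_L0)
  define S where "S = L0_coords D ` L0"
  have inj: "inj_on (L0_coords D) L0"
  proof (rule inj_onI)
    fix c c' assume c: "c \<in> L0" "c' \<in> L0" and eq: "L0_coords D c = L0_coords D c'"
    \<comment> \<open>Equal coordinates make the constant sequence \<open>c\<close> converge to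
      \<open>c'\<close>, so their distance is 0.\<close>
    have "(\<lambda>n::nat. L0_dist c c') \<longlonglongrightarrow> 0"
      by (rule L0_coords_tendsto_imp_L0_dist_tendsto[OF dense c]) (simp_all add: eq)
    then have "L0_dist c c' = 0" by (simp add: LIMSEQ_const_iff)
    then show "c = c'" using c by simp
  qed
  let ?g = "inv_into L0 (L0_coords D)"
  have coords: "continuous_map sharp_topology (top_of_set S) (L0_coords D)"
  proof -
    have "continuous_map sharp_topology euclidean (L0_coords D)"
      unfolding euclidean_product_topology[symmetric] continuous_map_componentwise_UNIV L0_coords_def
      by (intro allI continuous_map_sharp_integral continuous_on_test_fun bounded_test_fun)
    then show ?thesis
      by (auto simp: continuous_map_in_subtopology topspace_sharp_topology S_def)
  qed
  have inv: "continuous_map (top_of_set S) mtopology ?g"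
  proof (rule continuous_map_from_euclideanI)
    show "?g y \<in> L0" if "y \<in> S" for y
      using that unfolding S_def by (rule inv_into_into)
    fix \<sigma> l assume \<sigma>: "range \<sigma> \<subseteq> S" and l: "l \<in> S" and lim: "\<sigma> \<longlonglongrightarrow> l"
    have g: "?g y \<in> L0" "L0_coords D (?g y) = y" if "y \<in> S" for y
      using that unfolding S_def by (auto intro: inv_into_into f_inv_into_f)
    show "(\<lambda>n. L0_dist (?g (\<sigma> n)) (?g l)) \<longlonglongrightarrow> 0"
    proof (rule L0_coords_tendsto_imp_L0_dist_tendsto[OF dense])
      have "(\<lambda>n. \<sigma> n k) \<longlonglongrightarrow> l k" for k
        using lim continuous_on_tendsto_compose[OF continuous_on_product_coordinates lim] by simp
      then show "(\<lambda>n. L0_coords D (?g (\<sigma> n)) k) \<longlonglongrightarrow> L0_coords D (?g l) k" for k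
        using \<sigma> l by (simp add: g range_subsetD)
    qed (use \<sigma> l g in auto)
  qed
  \<comment> \<open>Coordinates are continuous for the coarser sharp topology, while their inverse
    is continuous into the finer metric topology. The same pair of maps is therefore a homeomorphism
    for both topologies; the metric one transfers completeness to \<open>S\<close>.\<close>
  have "homeomorphic_maps mtopology (top_of_set S) (L0_coords D) ?g"
    using continuous_map_compose[OF continuous_map_L0_sharp coords] inv inj
    by (auto simp: homeomorphic_maps_def S_def f_inv_into_f)
  then have "completely_metrizable_space (top_of_set S)"
    using homeomorphic_completely_metrizable_space completely_metrizable_space_mtopology[OF mcomplete_L0]
    unfolding homeomorphic_space_def by blast
  then have gdelta: "gdelta_in euclidean S"
    using completely_metrizable_space_eq_gdelta_in[of euclidean S] completely_metrizable_space_euclidean by auto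
  have "S \<in> sigma_sets UNIV {U. open U}"
  proof -
    obtain C where C: "\<And>n::nat. open (C n)" "S = \<Inter> (range C)"
      using gdelta unfolding gdelta_in_descending by auto
    have "S \<in> sets borel" unfolding C(2) by (intro sets.countable_INT) (auto intro: borel_open C(1))
    then show ?thesis by (simp add: borel_def)
  qed
  moreover have "(sharp_topology :: (real \<Rightarrow> 'u) set topology) homeomorphic_space top_of_set S"
    unfolding homeomorphic_space_def
  proof (intro exI)
    show "homeomorphic_maps sharp_topology (top_of_set S) (L0_coords D) ?g"
      using coords continuous_map_compose[OF inv continuous_map_L0_sharp] inj
      by (auto simp: homeomorphic_maps_def S_def f_inv_into_f topspace_sharp_topology)
  qed
  \<comment> \<open>The ambient space is the full sequence space with its product metric, complete
    and second countable.\<close>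
  moreover have "mcomplete_of (euclidean_metric :: (nat \<Rightarrow> real) metric)"
    by (simp add: mcomplete_of_def complete_UNIV)
  moreover have "separable_space (euclidean :: (nat \<Rightarrow> real) topology)"
  proof (rule second_countable_imp_separable_space)
    obtain B :: "(nat \<Rightarrow> real) set set" where "countable B" "topological_basis B"
      using ex_countable_basis by blast
    then show "second_countable (euclidean :: (nat \<Rightarrow> real) topology)"
      unfolding second_countable_def open_openin[symmetric]
      by (metis topological_basis_open topological_basisE)
  qed
  ultimately show ?thesis
    unfolding is_borel_space_def by (intro exI[of _ euclidean_metric]) auto
qed

end
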